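(* Let $m\geqslant 2$ and $d\geqslant 2$ be integers, let $f(X)=a_dX^d+\ldots+a_1X+a_0\in\mathbb{Z}_m[X]$ be a polynomial of degree $d$ with $\gcd(a_d,m)=1$, and let $\mathcal{I}=\{1,\ldots,H\}$ with $1\leqslant H\leqslant m$, considered as a subset of $\mathbb{Z}_m$. Then for any set $\mathcal{Z}\subseteq\mathbb{Z}_m$ of cardinality $\#\mathcal{Z}=Z$ we have $$E(\mathcal{Z},f(\mathcal{I}))\leqslant\left(\frac{H^2Z^2}{m^{2/d(d+1)}}+Z(H+Z)\right)H^{o(1)}.$$
   Context: $\mathbb{Z}_m$ denotes the residue ring modulo $m$, and $f(\mathcal{I})=\{f(u):u\in\mathcal{I}\}\subseteq\mathbb{Z}_m$ is the image set (computed in $\mathbb{Z}_m$). For sets $\mathcal{A},\mathcal{B}\subseteq\mathbb{Z}_m$, $E(\mathcal{A},\mathcal{B})$ is the number of quadruples $(a_1,a_2,b_1,b_2)$ with $a_1,a_2\in\mathcal{A}$, $b_1,b_2\in\mathcal{B}$ and $a_1+b_1=a_2+b_2$ in $\mathbb{Z}_m$. The notation $H^{o(1)}$ denotes a factor which, for every fixed $\varepsilon>0$, is at most $C(d,\varepsilon)H^{\varepsilon}$, with $C(d,\varepsilon)$ depending only on $d$ and $\varepsilon$. *)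

theory Defs
  imports "HOL-Number_Theory.Cong" "HOL-Computational_Algebra.Polynomial" Complex_Main
begin

text \<open>
  The modulus has to vary under a quantifier, so the residue ring modulo \<open>m\<close> is not a type here:
  a residue class is represented by its least nonnegative representative, i.e. by an integer in
  \<open>{0..<m}\<close>, and a polynomial over the residue ring by any lift of the same degree to \<open>int poly\<close>.
\<close>

definition additive_energy_mod :: "int \<Rightarrow> int set \<Rightarrow> int set \<Rightarrow> nat" where
  "additive_energy_mod m A B =
     card {(a1, a2, b1, b2). a1 \<in> A \<and> a2 \<in> A \<and> b1 \<in> B \<and> b2 \<in> B \<and> [a1 + b1 = a2 + b2] (mod m)}"

text \<open>
  Reducing the values makes this the image as a subset of the residue ring, without multiplicities:
  values congruent modulo \<open>m\<close> are counted once.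
\<close>

definition poly_image_mod :: "int \<Rightarrow> int poly \<Rightarrow> int set \<Rightarrow> int set" where
  "poly_image_mod m f U = (\<lambda>u. poly f u mod m) ` U"

end

theory Submission
  imports Defs "HOL-Library.FuncSet"
begin

text \<open>
  By Cauchy--Schwarz it suffices to treat intervals of length \<open>h\<close> with \<open>h ^ (d (d + 1) / 2) < m\<close>, as
  \<open>{1..H}\<close> is covered by at most \<open>2 H / h\<close> of them. On such an interval, a weighted form of Dirichlet's
  approximation theorem gives a multiplier \<open>0 < t < m\<close> and an integer polynomial \<open>P\<close> of degree \<open>d\<close>
  congruent to \<open>t f\<close> up to a constant, whose differences \<open>P x - P y\<close> on the interval are at most \<open>d m\<close>
  in absolute value. A congruence \<open>a + f x = b + f y\<close> then leaves, for given \<open>a\<close> and \<open>b\<close>, at most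
  \<open>2 d + 1\<close> values \<open>n\<close> of \<open>P x - P y\<close>. The pairs with \<open>n = 0\<close> number at most \<open>d h\<close>, and each of them
  contributes at most \<open>card Z\<close> solutions. If \<open>n \<noteq> 0\<close>, eliminating the coefficients of \<open>P\<close> shows that
  \<open>x - y\<close> divides a nonzero integer which is polynomially bounded in \<open>h\<close>, so that the divisor bound
  leaves only \<open>O(h powr \<epsilon>)\<close> values of \<open>x - y\<close>, each attained at most \<open>d\<close> times.
\<close>

section \<open>Elimination in integer linear systems with bounded entries\<close>

text \<open>
  The point is that the bound on \<open>n'\<close> does not involve \<open>c\<close> and \<open>n\<close>: it lets the final estimate be
  uniform when \<open>H\<close> is tiny compared with \<open>m\<close>. The right-hand sides \<open>\<beta>\<close> make the system homogeneous,
  so that eliminating the last coordinate stays inside the same class of systems.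
\<close>

lemma small_annihilator:
  fixes v :: "'a \<Rightarrow> nat \<Rightarrow> int" and \<beta> :: "'a \<Rightarrow> int"
  assumes "B \<ge> 1" and "\<And>s i. s \<in> S \<Longrightarrow> i < k \<Longrightarrow> \<bar>v s i\<bar> \<le> B"
    and "\<And>s. s \<in> S \<Longrightarrow> \<bar>\<beta> s\<bar> \<le> B"
    and "\<And>s. s \<in> S \<Longrightarrow> (\<Sum>i<k. c i * v s i) = n * \<beta> s" and "n \<noteq> 0"
  shows "\<exists>c' n'. n' \<noteq> 0 \<and> \<bar>n'\<bar> \<le> (2 * B) ^ (2 ^ k - 1) \<and>
           (\<forall>s\<in>S. (\<Sum>i<k. c' i * v s i) = n' * \<beta> s)"
  using assms
proof (induction k arbitrary: v \<beta> B)
  case 0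
  then show ?case by (intro exI[of _ "\<lambda>_. 0"] exI[of _ 1]) auto
next
  case (Suc k)
  show ?case
  proof (cases "\<forall>s\<in>S. v s k = 0")
    case True
    have "\<exists>c' n'. n' \<noteq> 0 \<and> \<bar>n'\<bar> \<le> (2 * B) ^ (2 ^ k - 1) \<and>
           (\<forall>s\<in>S. (\<Sum>i<k. c' i * v s i) = n' * \<beta> s)"
      using Suc.prems True by (intro Suc.IH) auto
    then obtain c' n' where *: "n' \<noteq> 0" "\<bar>n'\<bar> \<le> (2 * B) ^ (2 ^ k - 1)"
      "\<forall>s\<in>S. (\<Sum>i<k. c' i * v s i) = n' * \<beta> s" by blast
    have "(2 * B) ^ (2 ^ k - 1) \<le> (2 * B) ^ (2 ^ Suc k - 1)"
      using Suc.prems(1) by (intro power_increasing diff_le_mono) auto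
    with * True show ?thesis by (intro exI[of _ c'] exI[of _ n']) auto
  next
    case False
    then obtain w where w: "w \<in> S" "v w k \<noteq> 0" by blast
    \<comment> \<open>Cross-multiplying with the pivot row \<open>w\<close> makes coordinate
      \<open>k\<close> of every row vanish. Since \<open>\<beta>\<close> undergoes the same
      operation, the system keeps its shape with one unknown fewer, and \<open>B\<close> is replaced
      by \<open>2 * B\<^sup>2\<close>.\<close>
    define v' where "v' s i = v w k * v s i - v s k * v w i" for s i
    define \<beta>' where "\<beta>' s = v w k * \<beta> s - v s k * \<beta> w" for s
    have bd: "\<bar>a * b - a' * b'\<bar> \<le> 2 * B\<^sup>2"
      if "\<bar>a\<bar> \<le> B" "\<bar>b\<bar> \<le> B" "\<bar>a'\<bar> \<le> B" "\<bar>b'\<bar> \<le> B" for a b a' b' :: int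
    proof -
      have "\<bar>a * b\<bar> \<le> B\<^sup>2" "\<bar>a' * b'\<bar> \<le> B\<^sup>2"
        using that Suc.prems(1) by (auto simp: abs_mult power2_eq_square intro!: mult_mono)
      then show ?thesis by linarith
    qed
    have "\<exists>c' n'. n' \<noteq> 0 \<and> \<bar>n'\<bar> \<le> (2 * (2 * B\<^sup>2)) ^ (2 ^ k - 1) \<and>
           (\<forall>s\<in>S. (\<Sum>i<k. c' i * v' s i) = n' * \<beta>' s)"
    proof (intro Suc.IH)
      show "1 \<le> 2 * B\<^sup>2" using one_le_power[OF Suc.prems(1), of 2] by linarith
      show "\<bar>v' s i\<bar> \<le> 2 * B\<^sup>2" if "s \<in> S" "i < k" for s i
        unfolding v'_def using that w Suc.prems(2) by (intro bd) auto
      show "\<bar>\<beta>' s\<bar> \<le> 2 * B\<^sup>2" if "s \<in> S" for s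
        unfolding \<beta>'_def using that w Suc.prems(2,3) by (intro bd) auto
      show "(\<Sum>i<k. c i * v' s i) = n * \<beta>' s" if "s \<in> S" for s
      proof -
        have "(\<Sum>i<k. c i * v' s i) = (\<Sum>i<Suc k. c i * v' s i)" by (simp add: v'_def)
        also have "\<dots> = v w k * (\<Sum>i<Suc k. c i * v s i) - v s k * (\<Sum>i<Suc k. c i * v w i)"
          unfolding v'_def sum_distrib_left sum_subtractf[symmetric]
          by (intro sum.cong) (auto simp: algebra_simps)
        also have "\<dots> = n * \<beta>' s"
          unfolding Suc.prems(4)[OF that] Suc.prems(4)[OF w(1)] \<beta>'_def by (simp add: algebra_simps)
        finally show ?thesis .
      qed
    qed (use Suc.prems in auto)
    then obtain c' n' where *: "n' \<noteq> 0" "\<bar>n'\<bar> \<le> (2 * (2 * B\<^sup>2)) ^ (2 ^ k - 1)"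
      "\<And>s. s \<in> S \<Longrightarrow> (\<Sum>i<k. c' i * v' s i) = n' * \<beta>' s" by blast
    \<comment> \<open>Back substitution: the coefficients found so far are scaled by the pivot
      \<open>v w k\<close>, and the defect \<open>r\<close> of row \<open>w\<close> fixes the last
      one. The multiplier of \<open>\<beta>\<close> becomes \<open>v w k * n'\<close>.\<close>
    define r where "r = (\<Sum>i<k. c' i * v w i) - n' * \<beta> w"
    define c'' where "c'' i = (if i = k then - r else v w k * c' i)" for i
    have eq: "(\<Sum>i<Suc k. c'' i * v s i) = v w k * n' * \<beta> s" if "s \<in> S" for s
    proof -
      have "(\<Sum>i<k. c' i * v' s i) = v w k * (\<Sum>i<k. c' i * v s i) - v s k * (\<Sum>i<k. c' i * v w i)"
        unfolding v'_def sum_distrib_left sum_subtractf[symmetric]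
        by (intro sum.cong) (auto simp: algebra_simps)
      then have "v w k * (\<Sum>i<k. c' i * v s i) = n' * \<beta>' s + v s k * (\<Sum>i<k. c' i * v w i)"
        using *(3)[OF that] by simp
      moreover have "(\<Sum>i<Suc k. c'' i * v s i) = v w k * (\<Sum>i<k. c' i * v s i) - r * v s k"
        unfolding c''_def by (simp add: sum_distrib_left mult.assoc)
      ultimately show ?thesis
        by (simp add: r_def \<beta>'_def algebra_simps)
    qed
    \<comment> \<open>The pivot costs one factor \<open>B\<close>, and
      \<open>2 * (2 * B\<^sup>2)\<close> is the square of \<open>2 * B\<close>. So an exponent
      \<open>e\<close> turns into \<open>2 * e + 1\<close>, and starting from 0 this yields
      \<open>2 ^ k - 1\<close>.\<close>
    have "\<bar>v w k * n'\<bar> \<le> B * (2 * (2 * B\<^sup>2)) ^ (2 ^ k - 1)"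
      unfolding abs_mult using w Suc.prems(1,2) *(2) by (intro mult_mono) auto
    also have "2 * (2 * B\<^sup>2) = (2 * B) ^ 2" by (simp add: power2_eq_square)
    also have "B * ((2 * B) ^ 2) ^ (2 ^ k - 1) \<le> (2 * B) * ((2 * B) ^ 2) ^ (2 ^ k - 1)"
      using Suc.prems(1) by (intro mult_right_mono) auto
    also have "\<dots> = (2 * B) ^ Suc (2 * (2 ^ k - 1))" by (simp only: power_Suc power_mult)
    also have "Suc (2 * (2 ^ k - 1)) = 2 ^ Suc k - (1::nat)"
      by (cases "2 ^ k :: nat") (auto simp: algebra_simps)
    finally show ?thesis using eq *(1) w(2)
      by (intro exI[of _ c''] exI[of _ "v w k * n'"]) (auto simp del: sum.lessThan_Suc)
  qed
qed

section \<open>The divisor bound\<close>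

lemma card_divisors_prime_power_mult:
  fixes p m :: nat
  assumes "prime p" "m > 0"
  shows "card {e. e dvd p ^ a * m} \<le> (a + 1) * card {e. e dvd m}"
proof -
  have "{e. e dvd p ^ a * m} \<subseteq> (\<lambda>(i, e). p ^ i * e) ` ({..a} \<times> {e. e dvd m})"
  proof
    fix e assume "e \<in> {e. e dvd p ^ a * m}"
    then have "e dvd p ^ a * m" by simp
    then obtain x y where "e = x * y" "x dvd p ^ a" "y dvd m"
      using division_decomp by blast
    moreover from this obtain i where "i \<le> a" "x = p ^ i"
      using assms(1) divides_primepow_nat by blast
    ultimately show "e \<in> (\<lambda>(i, e). p ^ i * e) ` ({..a} \<times> {e. e dvd m})" by auto
  qed
  moreover have "finite ({..a} \<times> {e. e dvd m})" using assms by auto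
  ultimately have "card {e. e dvd p ^ a * m} \<le> card ({..a} \<times> {e. e dvd m})"
    by (meson surj_card_le)
  then show ?thesis by (simp add: card_cartesian_product)
qed

text \<open>Prime powers are stripped off one at a time, comparing the factor \<open>a + 1\<close>
  with \<open>(p ^ a) powr \<epsilon>\<close>. For \<open>p \<ge> Q\<close> nothing is lost; each of
  the finitely many primes below \<open>Q\<close> loses at most a factor \<open>K\<close>.\<close>

lemma divisor_bound:
  assumes "\<epsilon> > (0::real)"
  obtains C where "C > 0" "\<And>n::nat. n > 0 \<Longrightarrow> real (card {e. e dvd n}) \<le> C * real n powr \<epsilon>"
proof -
  define K where "K = 1 + 1 / (\<epsilon> * ln 2)"
  define Q where "Q = 2 powr (1 / \<epsilon>)"
  define X where "X n = {p::nat. prime p \<and> p dvd n \<and> real p < Q}" for n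
  have K1: "K \<ge> 1" using assms by (simp add: K_def)
  have fin: "finite {p::nat. real p < Q}"
    by (rule finite_subset[of _ "{..nat \<lceil>Q\<rceil>}"]) (auto, linarith)
  have finX: "finite (X n)" for n
    by (rule finite_subset[OF _ fin]) (auto simp: X_def)
  have small: "real (a + 1) \<le> K * real (p ^ a) powr \<epsilon>" if "prime p" for p a :: nat
  proof -
    \<comment> \<open>\<open>K\<close> is chosen so that both \<open>K\<close> and
      \<open>K * \<epsilon> * ln 2\<close> are at least 1; the exponential then enters through
      \<open>1 + x \<le> exp x\<close>.\<close>
    have "real (a + 1) \<le> K * (1 + real a * (\<epsilon> * ln 2))"
      using assms by (simp add: K_def field_simps)
    also have "\<dots> \<le> K * exp (real a * (\<epsilon> * ln 2))"
      using K1 by (intro mult_left_mono) auto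
    also have "exp (real a * (\<epsilon> * ln 2)) = (2 ^ a) powr \<epsilon>"
      by (simp add: powr_def ln_realpow algebra_simps)
    also have "K * (2 ^ a) powr \<epsilon> \<le> K * real (p ^ a) powr \<epsilon>"
      using K1 assms prime_ge_2_nat[OF that]
      by (intro mult_left_mono powr_mono2) (auto intro!: power_mono)
    finally show ?thesis .
  qed
  have large: "real (a + 1) \<le> real (p ^ a) powr \<epsilon>" if "real p \<ge> Q" for p a :: nat
  proof -
    have "2 = Q powr \<epsilon>" using assms by (simp add: Q_def powr_powr)
    also have "\<dots> \<le> real p powr \<epsilon>" using that assms by (intro powr_mono2) (auto simp: Q_def)
    finally have "2 ^ a \<le> (real p powr \<epsilon>) ^ a" by (intro power_mono) auto
    also have "\<dots> = real (p ^ a) powr \<epsilon>"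
      by (cases "p = 0") (auto simp: powr_powr powr_def ln_realpow exp_of_nat_mult[symmetric] algebra_simps power_0_left)
    finally have "2 ^ a \<le> real (p ^ a) powr \<epsilon>" .
    moreover have "real (a + 1) \<le> 2 ^ a"
      using of_nat_mono[OF Suc_leI[OF less_exp[of a]], where ?'a = real] by simp
    ultimately show ?thesis by linarith
  qed
  have main: "real (card {e. e dvd n}) \<le> K ^ card (X n) * real n powr \<epsilon>" if "n > 0" for n :: nat
    using that
  proof (induction n rule: less_induct)
    case (less n)
    show ?case
    proof (cases "n = 1")
      case True
      then show ?thesis using K1 by simp
    next
      case False
      then obtain p where p: "prime p" "p dvd n" using prime_factor_nat by blast
      obtain m where m: "n = p ^ multiplicity p n * m" "\<not> p dvd m"
      proof (rule multiplicity_decompose')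
        show "n \<noteq> 0" "\<not> is_unit p" using less.prems p(1) by auto
      qed
      define a where "a = multiplicity p n"
      have a: "n = p ^ a * m" "a > 0" using m p less.prems by (auto simp: a_def prime_multiplicity_gt_zero_iff)
      have m0: "m > 0" using m less.prems by (auto intro: gr0I)
      have dvd_n: "x dvd n \<longleftrightarrow> x = p \<or> x dvd m" if "prime x" for x
        unfolding a(1) using that p(1) a(2)
        by (auto simp: prime_dvd_mult_iff prime_dvd_power_iff dest: primes_dvd_imp_eq)
      have "1 < p ^ a" using a(2) prime_gt_1_nat[OF p(1)] by (rule one_less_power[rotated])
      then have "m < n" using a(1) m0 by simp
      then have IH: "real (card {e. e dvd m}) \<le> K ^ card (X m) * real m powr \<epsilon>"
        using m0 by (intro less.IH)
      have "real (card {e. e dvd n}) \<le> real ((a + 1) * card {e. e dvd m})"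
        unfolding a(1) using card_divisors_prime_power_mult[OF p(1) m0] of_nat_mono by blast
      also have "\<dots> \<le> real (a + 1) * (K ^ card (X m) * real m powr \<epsilon>)"
        using IH by (simp only: of_nat_mult) (intro mult_left_mono, auto)
      \<comment> \<open>If \<open>p < Q\<close>, then \<open>p\<close> is new in \<open>X n\<close>,
        and the extra factor \<open>K\<close> pays for it; otherwise \<open>X n\<close> equals
        \<open>X m\<close> and no payment is due.\<close>
      also have "\<dots> \<le> K ^ card (X n) * real (p ^ a) powr \<epsilon> * real m powr \<epsilon>"
      proof (cases "real p < Q")
        case True
        have "X n = insert p (X m)" using True p(1) dvd_n by (auto simp: X_def)
        moreover have "p \<notin> X m" using m by (auto simp: X_def)
        ultimately have "K ^ card (X n) = K * K ^ card (X m)" using finX by simp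
        then show ?thesis using mult_right_mono[OF small[OF p(1), of a], of "K ^ card (X m) * real m powr \<epsilon>"] K1
          by (simp add: algebra_simps)
      next
        case False
        have "X n = X m" using False p(1) dvd_n by (auto simp: X_def)
        then show ?thesis using mult_right_mono[OF large[of p a], of "K ^ card (X m) * real m powr \<epsilon>"] K1 False
          by (simp add: algebra_simps)
      qed
      also have "\<dots> = K ^ card (X n) * real n powr \<epsilon>"
        unfolding a(1) by (simp add: powr_mult)
      finally show ?thesis .
    qed
  qed
  show ?thesis
  proof (rule that)
    \<comment> \<open>Replacing \<open>X n\<close> by all naturals below \<open>Q\<close> makes the
      constant independent of \<open>n\<close>.\<close>
    show "real (card {e. e dvd n}) \<le> K ^ card {p::nat. real p < Q} * real n powr \<epsilon>" if "n > 0" for n :: nat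
    proof -
      have "K ^ card (X n) \<le> K ^ card {p::nat. real p < Q}"
        using K1 fin by (intro power_increasing card_mono) (auto simp: X_def)
      then show ?thesis using main[OF that] by (meson mult_right_mono order_trans powr_ge_zero)
    qed
    show "K ^ card {p::nat. real p < Q} > 0" using K1 by simp
  qed
qed

section \<open>Simultaneous Diophantine approximation\<close>

text \<open>Pigeonhole: \<open>F\<close> records in which of \<open>L i\<close> equal parts of
  \<open>[0, m)\<close> each residue \<open>t * a i mod m\<close> lies. There are \<open>N\<close>
  boxes for the \<open>N + 1\<close> values of \<open>t\<close> from 0 to \<open>N\<close>, and the
  difference of two values in one box is the desired multiplier.\<close>

lemma weighted_dirichlet:
  fixes m :: int and a :: "'i \<Rightarrow> int" and L :: "'i \<Rightarrow> nat"
  assumes "finite A" "m > 0" "\<And>i. i \<in> A \<Longrightarrow> L i \<ge> 1"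
  shows "\<exists>t b. 1 \<le> t \<and> t \<le> int (\<Prod>i\<in>A. L i) \<and> (\<forall>i\<in>A. \<bar>t * a i - m * b i\<bar> * int (L i) < m)"
proof -
  define N where "N = (\<Prod>i\<in>A. L i)"
  define F where "F t = (\<lambda>i\<in>A. nat ((t * a i mod m) * int (L i) div m))" for t :: int
  have "F ` {0..int N} \<subseteq> PiE A (\<lambda>i. {..<L i})"
  proof -
    have "nat ((t * a i mod m) * int (L i) div m) < L i" if "i \<in> A" for t i
    proof -
      have "(t * a i mod m) * int (L i) < m * int (L i)"
        using assms(2) assms(3)[OF that] by (intro mult_strict_right_mono) auto
      moreover have "(t * a i mod m) * int (L i) div m * m \<le> (t * a i mod m) * int (L i)"
        using assms(2) by (simp add: minus_mod_eq_div_mult[symmetric])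
      ultimately have "(t * a i mod m) * int (L i) div m * m < int (L i) * m"
        unfolding mult.commute[of m] by (rule le_less_trans[rotated])
      then have "(t * a i mod m) * int (L i) div m < int (L i)"
        by (rule mult_right_less_imp_less) (use assms(2) in simp)
      then show ?thesis using assms(3)[OF that] by linarith
    qed
    then show ?thesis by (auto simp: F_def)
  qed
  then have "card (F ` {0..int N}) \<le> card (PiE A (\<lambda>i. {..<L i}))"
    using assms(1) by (intro card_mono finite_PiE) auto
  also have "\<dots> = N" using assms(1) by (simp add: N_def card_PiE)
  finally have "card (F ` {0..int N}) \<le> N" .
  then have "\<not> inj_on F {0..int N}" using card_image by fastforce
  then obtain x y where "x \<in> {0..int N}" "y \<in> {0..int N}" "F x = F y" "x \<noteq> y"
    by (auto simp: inj_on_def)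
  then obtain x y where xy: "0 \<le> x" "x < y" "y \<le> int N" "F x = F y"
    by (cases "x < y") (auto intro: that[of x y] that[of y x])
  \<comment> \<open>With this \<open>b\<close> the quantity to bound is the difference of the two
    residues, which lie in the same part of length \<open>m / L i\<close>.\<close>
  define b where "b i = (y * a i) div m - (x * a i) div m" for i
  have "\<bar>(y - x) * a i - m * b i\<bar> * int (L i) < m" if "i \<in> A" for i
  proof -
    define p q where "p = (y * a i mod m) * int (L i)" and "q = (x * a i mod m) * int (L i)"
    have "nat (p div m) = nat (q div m)" using fun_cong[OF xy(4), of i] that by (simp add: F_def p_def q_def)
    moreover have "p \<ge> 0" "q \<ge> 0" using assms(2) by (simp_all add: p_def q_def)
    ultimately have "p div m = q div m" using assms(2) by (metis eq_nat_nat_iff pos_imp_zdiv_nonneg_iff)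
    then have "p - q = p mod m - q mod m" by (simp add: minus_mult_div_eq_mod[symmetric])
    then have "\<bar>p - q\<bar> < m" using assms(2) pos_mod_bound[of m p] pos_mod_bound[of m q] pos_mod_sign[of m p] pos_mod_sign[of m q] by linarith
    moreover have "(y - x) * a i - m * b i = y * a i mod m - x * a i mod m"
      by (simp add: b_def algebra_simps minus_div_mult_eq_mod[symmetric])
    ultimately show ?thesis by (simp add: p_def q_def left_diff_distrib[symmetric] abs_mult)
  qed
  then show ?thesis using xy by (intro exI[of _ "y - x"] exI[of _ b]) (auto simp: N_def)
qed

section \<open>Integer polynomials: differences and small multiples modulo \<open>m\<close>\<close>

text \<open>The values \<open>y\<close> are the roots of \<open>R\<close>, whose degree is at most
  that of \<open>P\<close>. If \<open>R\<close> vanished identically, \<open>P\<close> would agree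
  with a linear function along all nonnegative multiples of \<open>s\<close>, which degree at least
  2 forbids.\<close>

lemma card_fixed_difference:
  fixes P :: "int poly"
  assumes "degree P \<ge> 2" "s \<noteq> 0"
  shows "finite {y. poly P (y + s) - poly P y = n}" "card {y. poly P (y + s) - poly P y = n} \<le> degree P"
proof -
  define R where "R = pcompose P [:s, 1:] - P - [:n:]"
  have eq: "{y. poly P (y + s) - poly P y = n} = {y. poly R y = 0}"
    by (auto simp: R_def poly_pcompose algebra_simps)
  have "R \<noteq> 0"
  proof
    assume "R = 0"
    then have R0: "poly R y = 0" for y by simp
    have step: "poly P (y + s) = poly P y + n" for y
      using R0[of y] unfolding R_def by (simp add: poly_pcompose algebra_simps)
    have *: "poly P (s * int k) = poly P 0 + n * int k" for k
    proof (induction k)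
      case (Suc k)
      then show ?case using step[of "s * int k"] by (simp add: algebra_simps)
    qed simp
    \<comment> \<open>\<open>P\<close> composed with \<open>s * X\<close>, minus its putative linear
      form. It has infinitely many roots, and the composition has the degree of \<open>P\<close>
      because \<open>s \<noteq> 0\<close>.\<close>
    define T where "T = pcompose P [:0, s:] - [:poly P 0, n:]"
    have "range int \<subseteq> {y. poly T y = 0}"
      using * by (auto simp: T_def poly_pcompose algebra_simps)
    then have "infinite {y. poly T y = 0}"
      using finite_subset range_inj_infinite inj_of_nat by blast
    then have "T = 0" using poly_roots_finite by blast
    then have "degree (pcompose P [:0, s:]) \<le> 1" by (simp add: T_def)
    then show False using assms by (simp add: degree_pcompose)
  qed
  have "degree R \<le> degree P"
    unfolding R_def by (intro degree_diff_le) (auto simp: degree_pcompose)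
  then show "finite {y. poly P (y + s) - poly P y = n}" "card {y. poly P (y + s) - poly P y = n} \<le> degree P"
    unfolding eq using poly_roots_finite[OF \<open>R \<noteq> 0\<close>] card_poly_roots_bound[OF \<open>R \<noteq> 0\<close>] by linarith+
qed

text \<open>Dirichlet's theorem is applied with weight \<open>h ^ i\<close> on the coefficient of
  index \<open>i\<close>: the reduced coefficient is below \<open>m / h ^ i\<close>, so each term of
  \<open>P x - P y\<close> is at most \<open>m\<close> on the interval.\<close>

lemma small_multiple_poly:
  fixes g :: "int poly" and m :: int and h :: nat
  assumes "m > 0" "h \<ge> 1" "d \<ge> 1" "degree g = d" "coprime (lead_coeff g) m"
    and small: "int h ^ (\<Sum>{1..d}) < m"
  obtains P t where "degree P = d"
    "\<And>x y. [poly P x - poly P y = t * (poly g x - poly g y)] (mod m)"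
    "\<And>x y. x \<in> {1..int h} \<Longrightarrow> y \<in> {1..int h} \<Longrightarrow> \<bar>poly P x - poly P y\<bar> \<le> int d * m"
proof -
  have prod: "int (\<Prod>i\<in>{1..d}. h ^ i) = int h ^ (\<Sum>{1..d})" by (simp add: power_sum)
  have "\<exists>t b. 1 \<le> t \<and> t \<le> int (\<Prod>i\<in>{1..d}. h ^ i) \<and>
      (\<forall>i\<in>{1..d}. \<bar>t * coeff g i - m * b i\<bar> * int (h ^ i) < m)"
    using assms(1,2) by (intro weighted_dirichlet) auto
  then obtain t b where t: "1 \<le> t" "t \<le> int h ^ (\<Sum>{1..d})"
    and b: "\<And>i. i \<in> {1..d} \<Longrightarrow> \<bar>t * coeff g i - m * b i\<bar> * int (h ^ i) < m"
    unfolding prod by blast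
  define c where "c i = t * coeff g i - m * b i" for i
  define P where "P = (\<Sum>i\<in>{1..d}. monom (c i) i)"
  \<comment> \<open>The hypothesis \<open>small\<close> is used here: the multiplier is positive and
    below \<open>m\<close>, so the coprime leading coefficient cannot be reduced to 0 and the degree
    survives.\<close>
  have "\<not> m dvd t" using t small zdvd_imp_le by fastforce
  have "c d \<noteq> 0"
  proof
    assume "c d = 0"
    then have "m dvd t * lead_coeff g" using assms(4) by (simp add: c_def)
    with assms(5) \<open>\<not> m dvd t\<close> show False by (simp add: coprime_commute coprime_dvd_mult_left_iff)
  qed
  moreover have "coeff P d = c d" using assms(3) by (simp add: P_def coeff_sum)
  moreover have "degree P \<le> d"
    unfolding P_def by (intro degree_sum_le) (auto intro: order_trans[OF degree_monom_le])
  ultimately have "degree P = d" by (simp add: le_antisym le_degree)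
  moreover have diff: "poly P x - poly P y = (\<Sum>i\<in>{1..d}. c i * (x ^ i - y ^ i))" for x y
    by (simp add: P_def poly_sum poly_monom sum_subtractf right_diff_distrib)
  moreover have "[poly P x - poly P y = t * (poly g x - poly g y)] (mod m)" for x y
  proof -
    have "poly g x - poly g y = (\<Sum>i\<in>{..d}. coeff g i * (x ^ i - y ^ i))"
      by (simp add: poly_altdef assms(4) sum_subtractf right_diff_distrib)
    also have "\<dots> = (\<Sum>i\<in>{1..d}. coeff g i * (x ^ i - y ^ i))"
      by (rule sum.mono_neutral_right) (auto simp: not_less_eq_eq)
    finally have "poly P x - poly P y - t * (poly g x - poly g y) =
      (\<Sum>i\<in>{1..d}. - m * (b i * (x ^ i - y ^ i)))"
      unfolding diff by (simp add: sum_distrib_left sum_subtractf[symmetric] c_def algebra_simps)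
    then show ?thesis by (simp add: cong_iff_dvd_diff dvd_sum)
  qed
  moreover have "\<bar>poly P x - poly P y\<bar> \<le> int d * m" if "x \<in> {1..int h}" "y \<in> {1..int h}" for x y
  proof -
    have "\<bar>c i * (x ^ i - y ^ i)\<bar> \<le> m" if i: "i \<in> {1..d}" for i
    proof -
      \<comment> \<open>Both powers lie between 0 and \<open>h ^ i\<close>, so their difference
        costs no factor 2.\<close>
      have "0 \<le> x ^ i" "x ^ i \<le> int h ^ i" "0 \<le> y ^ i" "y ^ i \<le> int h ^ i"
        using \<open>x \<in> {1..int h}\<close> \<open>y \<in> {1..int h}\<close> by (auto intro: power_mono)
      then have "\<bar>x ^ i - y ^ i\<bar> \<le> int (h ^ i)" by simp
      then have "\<bar>c i * (x ^ i - y ^ i)\<bar> \<le> \<bar>c i\<bar> * int (h ^ i)"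
        unfolding abs_mult by (intro mult_left_mono) auto
      then show ?thesis using b[OF i] by (simp add: c_def)
    qed
    then have "(\<Sum>i\<in>{1..d}. \<bar>c i * (x ^ i - y ^ i)\<bar>) \<le> (\<Sum>i\<in>{1..d}. m)" by (intro sum_mono)
    then show ?thesis unfolding diff by (intro order_trans[OF sum_abs]) simp
  qed
  ultimately show ?thesis using that by blast
qed

text \<open>The constant must not depend on \<open>P\<close> or \<open>n\<close>, which may be huge
  compared with \<open>h\<close>. Hence the divisor bound is applied not to \<open>n\<close> but to
  the integer \<open>n'\<close> from \<open>small_annihilator\<close>, which is bounded by a power
  of \<open>2 * h ^ d\<close>.\<close>

lemma card_poly_diff_eq:
  fixes d :: nat and \<epsilon> :: real
  assumes "d \<ge> 2" "\<epsilon> > 0"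
  obtains C where "C > 0" "\<And>(P :: int poly) n (h::nat). degree P = d \<Longrightarrow> n \<noteq> 0 \<Longrightarrow> h \<ge> 1 \<Longrightarrow>
    real (card {(x, y). x \<in> {1..int h} \<and> y \<in> {1..int h} \<and> poly P x - poly P y = n}) \<le> C * real h powr \<epsilon>"
proof -
  define K :: nat where "K = 2 ^ d - 1"
  have "2 ^ d > (1::nat)" using assms(1) by (intro one_less_power) auto
  then have K: "K > 0" by (simp add: K_def)
  \<comment> \<open>With \<open>\<bar>n'\<bar> \<le> (2 * h ^ d) ^ K\<close>, this exponent turns
    the divisor bound into a constant times \<open>h powr \<epsilon>\<close>.\<close>
  define \<delta> where "\<delta> = \<epsilon> / (real d * real K)"
  have \<delta>: "\<delta> > 0" using assms K by (simp add: \<delta>_def)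
  obtain C where C: "C > 0" "\<And>n::nat. n > 0 \<Longrightarrow> real (card {e. e dvd n}) \<le> C * real n powr \<delta>"
    by (rule divisor_bound[OF \<delta>]) (rule that)
  show ?thesis
  proof (rule that)
    show "real d * (2 * (C * (2 ^ K) powr \<delta>)) > 0" using assms C by simp
    fix P :: "int poly" and n :: int and h :: nat
    assume P: "degree P = d" and "n \<noteq> 0" "h \<ge> 1"
    define S where "S = {(x, y). x \<in> {1..int h} \<and> y \<in> {1..int h} \<and> poly P x - poly P y = n}"
    define v where "v = (\<lambda>(x, y) i. x ^ Suc i - y ^ Suc i :: int)"
    \<comment> \<open>The rows are the vectors of power differences of the pairs in
      \<open>S\<close>, with \<open>\<beta>\<close> constantly 1; the nonconstant coefficients of
      \<open>P\<close> together with \<open>n\<close> solve the system.\<close>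
    have "\<exists>c' n'. n' \<noteq> 0 \<and> \<bar>n'\<bar> \<le> (2 * int h ^ d) ^ (2 ^ d - 1) \<and>
           (\<forall>s\<in>S. (\<Sum>i<d. c' i * v s i) = n' * 1)"
    proof (rule small_annihilator)
      show h1: "1 \<le> int h ^ d" using \<open>h \<ge> 1\<close> by (simp add: one_le_power)
      then show "\<bar>1\<bar> \<le> int h ^ d" by simp
      show "\<bar>v s i\<bar> \<le> int h ^ d" if "s \<in> S" "i < d" for s i
      proof -
        obtain x y where s: "s = (x, y)" "x \<in> {1..int h}" "y \<in> {1..int h}"
          using \<open>s \<in> S\<close> by (auto simp: S_def)
        have "0 \<le> x ^ Suc i" "x ^ Suc i \<le> int h ^ Suc i" "0 \<le> y ^ Suc i" "y ^ Suc i \<le> int h ^ Suc i"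
          using s by (auto intro!: power_mono simp del: power_Suc)
        moreover have "int h ^ Suc i \<le> int h ^ d"
          using that \<open>h \<ge> 1\<close> by (intro power_increasing) auto
        ultimately show ?thesis unfolding s(1) v_def prod.case by linarith
      qed
      show "(\<Sum>i<d. coeff P (Suc i) * v s i) = n * 1" if "s \<in> S" for s
      proof -
        obtain x y where s: "s = (x, y)" "poly P x - poly P y = n" using \<open>s \<in> S\<close> by (auto simp: S_def)
        have "poly P x - poly P y = (\<Sum>i<Suc d. coeff P i * (x ^ i - y ^ i))"
          by (simp add: poly_altdef P sum_subtractf right_diff_distrib lessThan_Suc_atMost
              del: sum.lessThan_Suc)
        then show ?thesis using s by (simp add: sum.lessThan_Suc_shift v_def del: sum.lessThan_Suc)
      qed
    qed fact
    then obtain c' n' where n': "n' \<noteq> 0" "\<bar>n'\<bar> \<le> (2 * int h ^ d) ^ K"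
      and c': "\<And>s. s \<in> S \<Longrightarrow> (\<Sum>i<d. c' i * v s i) = n'"
      unfolding K_def by auto
    define D where "D = {e. e dvd nat \<bar>n'\<bar>}"
    have finD: "finite D" unfolding D_def using n'(1) by (intro finite_divisors_nat) simp
    define Y where "Y s = (\<lambda>y. (y + s, y)) ` {y. poly P (y + s) - poly P y = n}" for s
    \<comment> \<open>Candidates for \<open>x - y\<close>, with both signs. Zero is not among them,
      since it does not divide \<open>n' \<noteq> 0\<close>.\<close>
    define I where "I = int ` D \<union> (\<lambda>e. - int e) ` D"
    have finI: "finite I" using finD by (simp add: I_def)
    have I0: "s \<noteq> 0" if "s \<in> I" for s using that n' by (auto simp: I_def D_def)
    have sub: "S \<subseteq> (\<Union>s\<in>I. Y s)"
    proof
      fix p assume p: "p \<in> S"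
      then obtain x y where xy: "p = (x, y)" "poly P x - poly P y = n" by (auto simp: S_def)
      \<comment> \<open>\<open>x - y\<close> divides every difference of like powers, hence also
        their integer combination \<open>n'\<close>.\<close>
      have "x - y dvd v p i" for i unfolding xy v_def prod.case by (simp only: power_diff_sumr2 dvd_triv_left)
      then have "x - y dvd n'" unfolding c'[OF p, symmetric] by (intro dvd_sum dvd_mult)
      then have "nat \<bar>x - y\<bar> \<in> D" by (auto simp: D_def nat_abs_dvd_iff)
      moreover have "x - y = int (nat \<bar>x - y\<bar>) \<or> x - y = - int (nat \<bar>x - y\<bar>)" by auto
      ultimately have "x - y \<in> I" unfolding I_def by blast
      moreover have "p \<in> Y (x - y)" using xy by (auto simp: Y_def)
      ultimately show "p \<in> (\<Union>s\<in>I. Y s)" by blast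
    qed
    have Y: "finite (Y s)" "card (Y s) \<le> d" if "s \<in> I" for s
      using card_fixed_difference[of P s n] I0[OF that] P assms(1) unfolding Y_def
      by (auto intro: order_trans[OF card_image_le])
    have "card S \<le> card (\<Union>s\<in>I. Y s)" using sub finI Y by (intro card_mono) auto
    also have "\<dots> \<le> (\<Sum>s\<in>I. card (Y s))" using finI by (rule card_UN_le)
    also have "\<dots> \<le> (\<Sum>s\<in>I. d)" using Y by (intro sum_mono)
    also have "\<dots> = d * card I" by simp
    also have "card I \<le> 2 * card D"
      unfolding I_def using card_Un_le[of "int ` D" "(\<lambda>e. - int e) ` D"]
        card_image_le[OF finD, of int] card_image_le[OF finD, of "\<lambda>e. - int e"] by linarith
    finally have "card S \<le> d * (2 * card D)" by simp
    then have "real (card S) \<le> real (d * (2 * card D))" by (rule of_nat_mono)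
    also have "\<dots> = real d * (2 * real (card D))" by simp
    also have "\<dots> \<le> real d * (2 * (C * (2 ^ K) powr \<delta> * real h powr \<epsilon>))"
    proof (intro mult_left_mono)
      have "real (card D) \<le> C * real (nat \<bar>n'\<bar>) powr \<delta>"
        unfolding D_def using n' by (intro C) auto
      also have "\<dots> \<le> C * ((2 * real h ^ d) ^ K) powr \<delta>"
      proof (intro mult_left_mono powr_mono2)
        have "real_of_int \<bar>n'\<bar> \<le> real_of_int ((2 * int h ^ d) ^ K)" using n' by (simp only: of_int_le_iff)
        then show "real (nat \<bar>n'\<bar>) \<le> (2 * real h ^ d) ^ K" by simp
      qed (use C \<delta> in auto)
      also have "((2 * real h ^ d) ^ K) powr \<delta> = (2 ^ K) powr \<delta> * (real h ^ (d * K)) powr \<delta>"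
        by (simp add: power_mult_distrib power_mult powr_mult)
      also have "(real h ^ (d * K)) powr \<delta> = real h powr \<epsilon>"
        using \<open>h \<ge> 1\<close> assms K by (simp add: powr_realpow[symmetric] powr_powr \<delta>_def)
      finally show "real (card D) \<le> C * (2 ^ K) powr \<delta> * real h powr \<epsilon>" by (simp add: mult_ac)
    qed auto
    also have "\<dots> = real d * (2 * (C * (2 ^ K) powr \<delta>)) * real h powr \<epsilon>" by simp
    finally show "real (card {(x, y). x \<in> {1..int h} \<and> y \<in> {1..int h} \<and> poly P x - poly P y = n})
      \<le> real d * (2 * (C * (2 ^ K) powr \<delta>)) * real h powr \<epsilon>"
      unfolding S_def .
  qed
qed

lemma card_poly_eq:
  fixes P :: "int poly"
  assumes "degree P \<ge> 1"
  shows "card {(x, y). x \<in> {1..int h} \<and> y \<in> {1..int h} \<and> poly P x = poly P y} \<le> h * degree P"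
proof -
  define Y where "Y x = Pair x ` {y. poly (P - [:poly P x:]) y = 0}" for x
  have Y: "finite (Y x)" "card (Y x) \<le> degree P" for x
  proof -
    have "P - [:poly P x:] \<noteq> 0"
    proof
      assume "P - [:poly P x:] = 0"
      then have "degree P = degree [:poly P x:]" by simp
      then show False using assms by simp
    qed
    moreover have "degree (P - [:poly P x:]) \<le> degree P" by (intro degree_diff_le) auto
    ultimately show "finite (Y x)" "card (Y x) \<le> degree P"
      using poly_roots_finite[of "P - [:poly P x:]"] card_poly_roots_bound[of "P - [:poly P x:]"]
      unfolding Y_def by (auto intro!: order_trans[OF card_image_le])
  qed
  have "card {(x, y). x \<in> {1..int h} \<and> y \<in> {1..int h} \<and> poly P x = poly P y} \<le> card (\<Union>x\<in>{1..int h}. Y x)"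
    using Y by (intro card_mono) (auto simp: Y_def)
  also have "\<dots> \<le> (\<Sum>x\<in>{1..int h}. card (Y x))" by (rule card_UN_le) simp
  also have "\<dots> \<le> (\<Sum>x\<in>{1..int h}. degree P)" using Y by (intro sum_mono)
  finally show ?thesis by simp
qed

section \<open>Collision counts and Cauchy--Schwarz\<close>

text \<open>Ordered pairs, diagonal included, so that the cardinality is the second moment of the
  fibre sizes of \<open>F\<close>. For the map \<open>(a, x)\<close> to \<open>a + f x\<close> it is
  the energy with values of \<open>f\<close> counted with multiplicity.\<close>

definition collisions :: "('a \<Rightarrow> 'b) \<Rightarrow> 'a set \<Rightarrow> ('a \<times> 'a) set" where
  "collisions F S = {(p, q). p \<in> S \<and> q \<in> S \<and> F p = F q}"

lemma card_collisions:
  assumes "finite S" "finite \<Lambda>" "F ` S \<subseteq> \<Lambda>"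
  shows "card (collisions F S) = (\<Sum>l\<in>\<Lambda>. (card {p \<in> S. F p = l})\<^sup>2)"
proof -
  have "collisions F S = (\<Union>l\<in>\<Lambda>. {p \<in> S. F p = l} \<times> {p \<in> S. F p = l})"
    using assms(3) by (auto simp: collisions_def)
  also have "card \<dots> = (\<Sum>l\<in>\<Lambda>. card ({p \<in> S. F p = l} \<times> {p \<in> S. F p = l}))"
    using assms(1,2) by (intro card_UN_disjoint) auto
  finally show ?thesis by (simp add: card_cartesian_product power2_eq_square)
qed

lemma square_sum_le:
  fixes x :: "'a \<Rightarrow> nat"
  shows "(\<Sum>j\<in>J. x j)\<^sup>2 \<le> card J * (\<Sum>j\<in>J. (x j)\<^sup>2)"
proof -
  have "2 * x i * x j \<le> (x i)\<^sup>2 + (x j)\<^sup>2" for i j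
  proof -
    have "0 \<le> (int (x i) - int (x j))\<^sup>2" by simp
    then have "int (2 * x i * x j) \<le> int ((x i)\<^sup>2 + (x j)\<^sup>2)" by (simp add: power2_diff)
    then show ?thesis by (simp only: of_nat_le_iff)
  qed
  then have "(\<Sum>i\<in>J. \<Sum>j\<in>J. 2 * x i * x j) \<le> (\<Sum>i\<in>J. \<Sum>j\<in>J. (x i)\<^sup>2 + (x j)\<^sup>2)"
    by (intro sum_mono)
  also have "\<dots> = 2 * (card J * (\<Sum>j\<in>J. (x j)\<^sup>2))"
    by (simp add: sum.distrib flip: sum_distrib_left)
  also have "(\<Sum>i\<in>J. \<Sum>j\<in>J. 2 * x i * x j) = 2 * (\<Sum>j\<in>J. x j)\<^sup>2"
    by (simp add: power2_eq_square mult.assoc flip: sum_distrib_left sum_distrib_right)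
  finally show ?thesis by simp
qed

text \<open>On each fibre, Cauchy--Schwarz bounds the square of a sum over the pieces by
  \<open>card J\<close> times the sum of squares. Only collisions inside a single piece remain. The
  pieces may overlap and may reach beyond \<open>S\<close>.\<close>

lemma collisions_cover:
  assumes "finite J" "\<And>j. j \<in> J \<Longrightarrow> finite (T j)" "S \<subseteq> (\<Union>j\<in>J. T j)"
  shows "card (collisions F S) \<le> card J * (\<Sum>j\<in>J. card (collisions F (T j)))"
proof -
  define \<Lambda> where "\<Lambda> = F ` (\<Union>j\<in>J. T j)"
  define r where "r X l = card {p \<in> X. F p = l}" for X l
  have "finite (\<Union>j\<in>J. T j)" using assms(1,2) by blast
  then have fin: "finite \<Lambda>" "finite S" using assms(3) finite_subset by (auto simp: \<Lambda>_def)
  have rS: "(r S l)\<^sup>2 \<le> card J * (\<Sum>j\<in>J. (r (T j) l)\<^sup>2)" for l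
  proof -
    have "r S l \<le> card (\<Union>j\<in>J. {p \<in> T j. F p = l})"
      unfolding r_def using assms by (intro card_mono) auto
    also have "\<dots> \<le> (\<Sum>j\<in>J. r (T j) l)" unfolding r_def using assms(1) by (rule card_UN_le)
    finally have "(r S l)\<^sup>2 \<le> (\<Sum>j\<in>J. r (T j) l)\<^sup>2" by (intro power_mono) auto
    then show ?thesis using square_sum_le[of "\<lambda>j. r (T j) l" J] by linarith
  qed
  have "card (collisions F S) = (\<Sum>l\<in>\<Lambda>. (r S l)\<^sup>2)"
    unfolding r_def using assms fin by (intro card_collisions) (auto simp: \<Lambda>_def)
  also have "\<dots> \<le> (\<Sum>l\<in>\<Lambda>. card J * (\<Sum>j\<in>J. (r (T j) l)\<^sup>2))" using rS by (intro sum_mono)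
  also have "\<dots> = card J * (\<Sum>j\<in>J. \<Sum>l\<in>\<Lambda>. (r (T j) l)\<^sup>2)"
    by (simp add: sum_distrib_left[symmetric] sum.swap[of _ J])
  also have "(\<Sum>j\<in>J. \<Sum>l\<in>\<Lambda>. (r (T j) l)\<^sup>2) = (\<Sum>j\<in>J. card (collisions F (T j)))"
    unfolding r_def using assms fin by (intro sum.cong card_collisions[symmetric]) (auto simp: \<Lambda>_def)
  finally show ?thesis .
qed

section \<open>Energy on short intervals\<close>

text \<open>Within a residue class \<open>n\<close> is determined by \<open>n div m\<close>, which
  ranges over \<open>{- d..d}\<close>.\<close>

lemma card_residues_in_window:
  fixes m c :: int
  assumes "m > 0"
  shows "finite {n. \<bar>n\<bar> \<le> int d * m \<and> [n = c] (mod m)}"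
    and "card {n. \<bar>n\<bar> \<le> int d * m \<and> [n = c] (mod m)} \<le> 2 * d + 1"
proof -
  let ?N = "{n. \<bar>n\<bar> \<le> int d * m \<and> [n = c] (mod m)}"
  show "finite ?N"
    by (rule finite_subset[of _ "{- (int d * m)..int d * m}"]) auto
  have inj: "inj_on (\<lambda>n. n div m) ?N"
  proof (rule inj_onI)
    fix x y assume "x \<in> ?N" "y \<in> ?N" "x div m = y div m"
    then have "x mod m = y mod m" by (simp add: cong_def)
    with \<open>x div m = y div m\<close> show "x = y" by (metis div_mult_mod_eq)
  qed
  have "(\<lambda>n. n div m) ` ?N \<subseteq> {- int d..int d}"
  proof (rule image_subsetI)
    fix n assume "n \<in> ?N"
    then have "- int d * m \<le> n" "n \<le> int d * m" by auto
    then have "(- int d * m) div m \<le> n div m" "n div m \<le> (int d * m) div m"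
      using zdiv_mono1[OF _ assms] by blast+
    moreover have "(- int d * m) div m = - int d" "(int d * m) div m = int d"
      using assms by (simp_all only: nonzero_mult_div_cancel_right less_imp_neq[THEN not_sym] not_False_eq_True)
    ultimately show "n div m \<in> {- int d..int d}" by auto
  qed
  then have "card ((\<lambda>n. n div m) ` ?N) \<le> card {- int d..int d}" by (intro card_mono) auto
  then show "card ?N \<le> 2 * d + 1" by (simp add: card_image[OF inj])
qed

lemma short_interval_energy:
  fixes d :: nat and \<epsilon> :: real
  assumes "d \<ge> 2" "\<epsilon> > 0"
  obtains C where "C > 0" "\<And>(m::int) (h::nat) g Z. \<lbrakk>m > 0; h \<ge> 1; degree g = d; coprime (lead_coeff g) m;
      int h ^ (\<Sum>{1..d}) < m; Z \<subseteq> {0..<m}\<rbrakk> \<Longrightarrow>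
    real (card (collisions (\<lambda>(a, x). (a + poly g x) mod m) (Z \<times> {1..int h})))
      \<le> C * (real (card Z) * (real h + real (card Z))) * real h powr \<epsilon>"
proof -
  obtain C where C: "C > 0" "\<And>(P :: int poly) n (h::nat). degree P = d \<Longrightarrow> n \<noteq> 0 \<Longrightarrow> h \<ge> 1 \<Longrightarrow>
    real (card {(x, y). x \<in> {1..int h} \<and> y \<in> {1..int h} \<and> poly P x - poly P y = n}) \<le> C * real h powr \<epsilon>"
    by (rule card_poly_diff_eq[OF assms]) (rule that)
  show ?thesis
  proof (rule that)
    \<comment> \<open>The first summand comes from \<open>T1\<close>, the second from
      \<open>T2\<close>: at most \<open>2 * d + 1\<close> values of \<open>P x - P y\<close> for
      each \<open>a\<close> and \<open>b\<close>, each attained by at most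
      \<open>C * h powr \<epsilon>\<close> pairs.\<close>
    show "real d + real (2 * d + 1) * C > 0" using C by (simp add: add_nonneg_pos)
    fix m :: int and h :: nat and g :: "int poly" and Z :: "int set"
    assume m: "m > 0" and h: "h \<ge> 1" and g: "degree g = d" "coprime (lead_coeff g) m"
      and small: "int h ^ (\<Sum>{1..d}) < m" and Z: "Z \<subseteq> {0..<m}"
    have d1: "d \<ge> 1" using assms(1) by simp
    obtain P t where P: "degree P = d"
      and cong: "\<And>x y. [poly P x - poly P y = t * (poly g x - poly g y)] (mod m)"
      and bound: "\<And>x y. x \<in> {1..int h} \<Longrightarrow> y \<in> {1..int h} \<Longrightarrow> \<bar>poly P x - poly P y\<bar> \<le> int d * m"
      by (rule small_multiple_poly[OF m h d1 g small]) (rule that)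
    have finZ: "finite Z" using Z finite_subset by blast
    define E where "E = collisions (\<lambda>(a, x). (a + poly g x) mod m) (Z \<times> {1..int h})"
    define W where "W n = {(x, y). x \<in> {1..int h} \<and> y \<in> {1..int h} \<and> poly P x - poly P y = n}" for n
    \<comment> \<open>For \<open>l = b - a\<close>: the nonzero values left to
      \<open>P x - P y\<close> by the congruence and the size bound.\<close>
    define N where "N l = {n. \<bar>n\<bar> \<le> int d * m \<and> [n = t * l] (mod m)} - {0}" for l
    \<comment> \<open>Pairs with \<open>P x = P y\<close> need not satisfy \<open>a = b\<close> when \<open>m\<close> is composite, but there are few of them.\<close>
    define T1 where "T1 = (\<lambda>(a, x, y). ((a, x), ((a + poly g x - poly g y) mod m, y))) ` (Z \<times> W 0)"
    define T2 where "T2 = (\<Union>(a, b)\<in>Z \<times> Z. \<Union>n\<in>N (b - a). (\<lambda>(x, y). ((a, x), (b, y))) ` W n)"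
    have finW: "finite (W n)" for n
      by (rule finite_subset[of _ "{1..int h} \<times> {1..int h}"]) (auto simp: W_def)
    have N: "finite (N l)" "card (N l) \<le> 2 * d + 1" for l
      using card_residues_in_window[OF m, of d "t * l"] unfolding N_def
      by (auto intro: order_trans[OF card_Diff1_le])
    have "E \<subseteq> T1 \<union> T2"
    proof
      fix e assume "e \<in> E"
      then obtain a x b y where e: "e = ((a, x), (b, y))" "a \<in> Z" "b \<in> Z" "x \<in> {1..int h}" "y \<in> {1..int h}"
        "(a + poly g x) mod m = (b + poly g y) mod m"
        by (auto simp: E_def collisions_def)
      have eq: "[a + poly g x = b + poly g y] (mod m)" using e by (simp add: cong_def)
      show "e \<in> T1 \<union> T2"
      proof (cases "poly P x = poly P y")
        case True
        \<comment> \<open>\<open>b\<close> is its own residue because \<open>Z\<close> consists of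
          reduced representatives, so \<open>a\<close>, \<open>x\<close> and \<open>y\<close>
          determine it.\<close>
        have "[a + poly g x - poly g y = b] (mod m)" using cong_diff[OF eq cong_refl, of "poly g y"] by simp
        then have "b = (a + poly g x - poly g y) mod m" using e(3) Z by (auto simp: cong_def)
        moreover have "(a, x, y) \<in> Z \<times> W 0" using True e by (simp add: W_def)
        ultimately have "e \<in> T1" unfolding T1_def e(1) by (intro image_eqI) auto
        then show ?thesis ..
      next
        case False
        have "[poly g x - poly g y = b - a] (mod m)"
          using cong_diff[OF eq cong_refl, of "a + poly g y"] by (simp add: algebra_simps)
        then have "[poly P x - poly P y = t * (b - a)] (mod m)"
          using cong cong_trans cong_scalar_left by blast
        then have "poly P x - poly P y \<in> N (b - a)" using bound e False by (simp add: N_def)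
        moreover have "(x, y) \<in> W (poly P x - poly P y)" using e by (simp add: W_def)
        ultimately have "e \<in> (\<Union>n\<in>N (b - a). (\<lambda>(x, y). ((a, x), (b, y))) ` W n)"
          unfolding e(1) by (intro UN_I[of "poly P x - poly P y"] image_eqI[of _ _ "(x, y)"]) auto
        then have "e \<in> T2" unfolding T2_def using e(2,3) by (intro UN_I[of "(a, b)"]) auto
        then show ?thesis ..
      qed
    qed
    moreover have "finite (T1 \<union> T2)" using finZ finW N by (auto simp: T1_def T2_def)
    ultimately have "card E \<le> card (T1 \<union> T2)" by (rule card_mono[rotated])
    then have "card E \<le> card T1 + card T2" using card_Un_le[of T1 T2] by linarith
    moreover have "real (card T1) \<le> real d * (real (card Z) * real h) * real h powr \<epsilon>"
    proof -
      have "card T1 \<le> card (Z \<times> W 0)" unfolding T1_def using finZ finW by (intro card_image_le) auto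
      also have "\<dots> \<le> card Z * (h * d)"
        using card_poly_eq[of P h] P d1 by (simp add: card_cartesian_product W_def)
      finally have "real (card T1) \<le> real (card Z * (h * d))" by (rule of_nat_mono)
      also have "\<dots> = real d * (real (card Z) * real h) * 1" by simp
      also have "\<dots> \<le> real d * (real (card Z) * real h) * real h powr \<epsilon>"
        using h assms by (intro mult_left_mono ge_one_powr_ge_zero) auto
      finally show ?thesis .
    qed
    moreover have "real (card T2) \<le> real (2 * d + 1) * C * (real (card Z) * real (card Z)) * real h powr \<epsilon>"
    proof -
      have "real (card T2) \<le> real (\<Sum>(a, b)\<in>Z \<times> Z. card (\<Union>n\<in>N (b - a). (\<lambda>(x, y). ((a, x), (b, y))) ` W n))"
        unfolding T2_def case_prod_unfold by (rule of_nat_mono, rule card_UN_le) (simp add: finZ)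
      also have "\<dots> = (\<Sum>(a, b)\<in>Z \<times> Z. real (card (\<Union>n\<in>N (b - a). (\<lambda>(x, y). ((a, x), (b, y))) ` W n)))"
        by (simp add: case_prod_unfold)
      also have "\<dots> \<le> (\<Sum>(a, b)\<in>Z \<times> Z. real (2 * d + 1) * (C * real h powr \<epsilon>))"
      proof (intro sum_mono, clarify)
        fix a b
        have "card (\<Union>n\<in>N (b - a). (\<lambda>(x, y). ((a, x), (b, y))) ` W n)
          \<le> (\<Sum>n\<in>N (b - a). card ((\<lambda>(x, y). ((a, x), (b, y))) ` W n))" by (rule card_UN_le) (rule N)
        also have "\<dots> \<le> (\<Sum>n\<in>N (b - a). card (W n))" by (intro sum_mono card_image_le finW)
        finally have "real (card (\<Union>n\<in>N (b - a). (\<lambda>(x, y). ((a, x), (b, y))) ` W n))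
          \<le> (\<Sum>n\<in>N (b - a). real (card (W n)))" by (simp flip: of_nat_sum)
        also have "\<dots> \<le> (\<Sum>n\<in>N (b - a). C * real h powr \<epsilon>)"
          unfolding W_def using P h by (intro sum_mono C) (auto simp: N_def)
        also have "\<dots> = real (card (N (b - a))) * (C * real h powr \<epsilon>)" by simp
        also have "\<dots> \<le> real (2 * d + 1) * (C * real h powr \<epsilon>)"
          using N(2) C(1) by (intro mult_right_mono of_nat_mono) auto
        finally show "real (card (\<Union>n\<in>N (b - a). (\<lambda>(x, y). ((a, x), (b, y))) ` W n))
          \<le> real (2 * d + 1) * (C * real h powr \<epsilon>)" .
      qed
      also have "\<dots> = real (2 * d + 1) * C * (real (card Z) * real (card Z)) * real h powr \<epsilon>"
        by (simp add: card_cartesian_product case_prod_unfold)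
      finally show ?thesis .
    qed
    ultimately have "real (card E) \<le> real d * (real (card Z) * real h) * real h powr \<epsilon>
      + real (2 * d + 1) * C * (real (card Z) * real (card Z)) * real h powr \<epsilon>" by linarith
    also have "\<dots> \<le> (real d + real (2 * d + 1) * C) * (real (card Z) * (real h + real (card Z))) * real h powr \<epsilon>"
    proof -
      have "p * (z * k) * w + q * (z * z) * w \<le> (p + q) * (z * (k + z)) * w"
        if "p \<ge> 0" "q \<ge> 0" "z \<ge> 0" "k \<ge> 0" "w \<ge> 0" for p q z k w :: real
      proof -
        have "(p + q) * (z * (k + z)) * w = p * (z * k) * w + q * (z * z) * w + (p * (z * z) * w + q * (z * k) * w)"
          by (simp add: algebra_simps)
        then show ?thesis using that by simp
      qed
      then show ?thesis using C(1) by simp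
    qed
    finally show "real (card (collisions (\<lambda>(a, x). (a + poly g x) mod m) (Z \<times> {1..int h})))
      \<le> (real d + real (2 * d + 1) * C) * (real (card Z) * (real h + real (card Z))) * real h powr \<epsilon>"
      unfolding E_def .
  qed
qed

section \<open>From short intervals to the full interval\<close>

text \<open>The energy counts each value of \<open>f\<close> once, whereas collisions count
  arguments; choosing preimages lifts every energy quadruple to a collision.\<close>

lemma additive_energy_le_collisions:
  assumes "finite Z" "finite U"
  shows "additive_energy_mod m Z (poly_image_mod m f U)
    \<le> card (collisions (\<lambda>(a, x). (a + poly f x) mod m) (Z \<times> U))"
proof -
  let ?E = "collisions (\<lambda>(a, x). (a + poly f x) mod m) (Z \<times> U)"
  let ?r = "\<lambda>((a, x), (b, y)). (a, b, poly f x mod m, poly f y mod m)"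
  have fin: "finite ?E"
    by (rule finite_subset[of _ "(Z \<times> U) \<times> (Z \<times> U)"]) (use assms in \<open>auto simp: collisions_def\<close>)
  have "{(a1, a2, b1, b2). a1 \<in> Z \<and> a2 \<in> Z \<and> b1 \<in> poly_image_mod m f U \<and> b2 \<in> poly_image_mod m f U \<and>
      [a1 + b1 = a2 + b2] (mod m)} \<subseteq> ?r ` ?E"
  proof clarify
    fix a b p q
    assume *: "a \<in> Z" "b \<in> Z" "p \<in> poly_image_mod m f U" "q \<in> poly_image_mod m f U" "[a + p = b + q] (mod m)"
    then obtain x y where "x \<in> U" "y \<in> U" "p = poly f x mod m" "q = poly f y mod m"
      by (auto simp: poly_image_mod_def)
    with * show "(a, b, p, q) \<in> ?r ` ?E"
      by (intro image_eqI[of _ _ "((a, x), (b, y))"]) (auto simp: collisions_def cong_def mod_simps)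
  qed
  then have "additive_energy_mod m Z (poly_image_mod m f U) \<le> card (?r ` ?E)"
    unfolding additive_energy_mod_def using fin by (intro card_mono) auto
  also have "\<dots> \<le> card ?E" using fin by (rule card_image_le)
  finally show ?thesis .
qed

text \<open>Moves each piece of the cover to an interval starting at 1, where
  \<open>short_interval_energy\<close> applies.\<close>

lemma card_collisions_shift:
  fixes f g :: "int poly"
  assumes "finite Z" "\<And>x. poly g x = poly f (u + x)"
  shows "card (collisions (\<lambda>(a, x). (a + poly f x) mod m) (Z \<times> {u + 1..u + k}))
    \<le> card (collisions (\<lambda>(a, x). (a + poly g x) mod m) (Z \<times> {1..k}))"
proof -
  let ?G = "collisions (\<lambda>(a, x). (a + poly g x) mod m) (Z \<times> {1..k})"
  have fin: "finite ?G"
    by (rule finite_subset[of _ "(Z \<times> {1..k}) \<times> (Z \<times> {1..k})"]) (use assms in \<open>auto simp: collisions_def\<close>)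
  have "collisions (\<lambda>(a, x). (a + poly f x) mod m) (Z \<times> {u + 1..u + k})
    \<subseteq> (\<lambda>((a, x), (b, y)). ((a, u + x), (b, u + y))) ` ?G"
  proof
    fix e assume "e \<in> collisions (\<lambda>(a, x). (a + poly f x) mod m) (Z \<times> {u + 1..u + k})"
    then obtain a x b y where "e = ((a, x), (b, y))" "a \<in> Z" "b \<in> Z" "x \<in> {u + 1..u + k}" "y \<in> {u + 1..u + k}"
        "(a + poly f x) mod m = (b + poly f y) mod m"
      by (auto simp: collisions_def)
    then show "e \<in> (\<lambda>((a, x), (b, y)). ((a, u + x), (b, u + y))) ` ?G"
      by (intro image_eqI[of _ _ "((a, x - u), (b, y - u))"]) (auto simp: collisions_def assms(2))
  qed
  then show ?thesis using fin by (meson surj_card_le)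
qed

theorem theorem1p2:
  fixes d :: nat
  assumes "d \<ge> 2"
  shows "\<forall>\<epsilon>::real. \<epsilon> > 0 \<longrightarrow> (\<exists>C::real. \<forall>(m::int) (H::int) (f::int poly) (Z::int set).
    m \<ge> 2 \<longrightarrow> degree f = d \<longrightarrow> coprime (lead_coeff f) m \<longrightarrow> 1 \<le> H \<longrightarrow> H \<le> m \<longrightarrow> Z \<subseteq> {0..<m} \<longrightarrow>
      real (additive_energy_mod m Z (poly_image_mod m f {1..H}))
        \<le> ((real_of_int H)\<^sup>2 * (real (card Z))\<^sup>2 / real_of_int m powr (2 / (real d * (real d + 1)))
            + real (card Z) * (real_of_int H + real (card Z)))
          * (C * real_of_int H powr \<epsilon>))"
proof (intro allI impI)
  fix \<epsilon> :: real assume "\<epsilon> > 0"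
  obtain C where C: "C > 0" and short: "\<And>(m::int) (h::nat) g Z. \<lbrakk>m > 0; h \<ge> 1; degree g = d; coprime (lead_coeff g) m;
      int h ^ (\<Sum>{1..d}) < m; Z \<subseteq> {0..<m}\<rbrakk> \<Longrightarrow>
    real (card (collisions (\<lambda>(a, x). (a + poly g x) mod m) (Z \<times> {1..int h})))
      \<le> C * (real (card Z) * (real h + real (card Z))) * real h powr \<epsilon>"
    by (rule short_interval_energy[OF assms \<open>\<epsilon> > 0\<close>]) (rule that)
  \<comment> \<open>\<open>1 / D\<close> is the exponent \<open>2 / (d * (d + 1))\<close> of the
    theorem.\<close>
  define D where "D = \<Sum>{1..d}"
  have D: "real D = real d * (real d + 1) / 2"
  proof -
    have "2 * D = d * (d + 1)" unfolding D_def using gauss_sum_from_Suc_0[of d, where 'a = nat] by simp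
    then have "real (2 * D) = real (d * (d + 1))" by (rule arg_cong)
    then show ?thesis by (simp add: algebra_simps)
  qed
  have D0: "D > 0"
  proof (rule gr0I)
    assume "D = 0"
    with D assms show False by (simp add: add_eq_0_iff)
  qed
  show "\<exists>C::real. \<forall>(m::int) (H::int) (f::int poly) (Z::int set).
    m \<ge> 2 \<longrightarrow> degree f = d \<longrightarrow> coprime (lead_coeff f) m \<longrightarrow> 1 \<le> H \<longrightarrow> H \<le> m \<longrightarrow> Z \<subseteq> {0..<m} \<longrightarrow>
      real (additive_energy_mod m Z (poly_image_mod m f {1..H}))
        \<le> ((real_of_int H)\<^sup>2 * (real (card Z))\<^sup>2 / real_of_int m powr (2 / (real d * (real d + 1)))
            + real (card Z) * (real_of_int H + real (card Z)))
          * (C * real_of_int H powr \<epsilon>)"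
  \<comment> \<open>The factor 16 is \<open>4 * 2 * 2\<close>, from \<open>K \<le> 2 * H / h\<close>
    squared, \<open>z * (h + z) \<le> 2 * h * z\<^sup>2\<close> and
    \<open>M \<le> 2 * h\<close>.\<close>
  proof (intro exI[of _ "16 * C"] allI impI)
    fix m H0 :: int and f :: "int poly" and Z :: "int set"
    assume m: "m \<ge> 2" and f: "degree f = d" "coprime (lead_coeff f) m" and "1 \<le> H0" and Z: "Z \<subseteq> {0..<m}"
    define H where "H = nat H0"
    have H: "H0 = int H" "H \<ge> 1" using \<open>1 \<le> H0\<close> by (auto simp: H_def)
    have finZ: "finite Z" using Z finite_subset by blast
    define z where "z = real (card Z)"
    define M where "M = real_of_int m powr (2 / (real d * (real d + 1)))"
    \<comment> \<open>The longest admissible length up to \<open>H\<close>; length 1 qualifies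
      because \<open>m \<ge> 2\<close>. If \<open>h < H\<close>, then \<open>h + 1\<close> fails,
      which forces \<open>M \<le> h + 1\<close>.\<close>
    define h where "h = Max {h \<in> {1..H}. int h ^ D < m}"
    have "h \<in> {h \<in> {1..H}. int h ^ D < m}"
      unfolding h_def using H m by (intro Max_in) (auto intro!: exI[of _ 1])
    then have h: "1 \<le> h" "h \<le> H" "int h ^ D < m" by auto
    have large: "M \<le> 2 * real h" if "h < H"
    proof -
      have "\<not> int (h + 1) ^ D < m"
      proof
        assume "int (h + 1) ^ D < m"
        with that have "h + 1 \<le> h" unfolding h_def by (intro Max_ge) auto
        then show False by simp
      qed
      then have "real_of_int m \<le> real_of_int (int (h + 1) ^ D)" by (simp only: not_less of_int_le_iff)
      then have "real_of_int m \<le> real (h + 1) ^ D" by simp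
      then have "real_of_int m powr (1 / real D) \<le> (real (h + 1) ^ D) powr (1 / real D)"
        using m by (intro powr_mono2) auto
      also have "\<dots> = real (h + 1)" using D0 by (simp add: powr_realpow[symmetric] powr_powr)
      also have "\<dots> \<le> 2 * real h" using h by simp
      finally show ?thesis by (simp add: M_def D)
    qed
    \<comment> \<open>The extra block covers the remainder and may reach past \<open>H\<close>. The
      bound \<open>K * h \<le> 2 * H\<close> relies on \<open>h \<le> H\<close>.\<close>
    define K where "K = H div h + 1"
    have "K * h = H div h * h + h" by (simp add: K_def)
    also have "\<dots> \<le> 2 * H" using h div_times_less_eq_dividend[of H h] by linarith
    finally have "real (K * h) \<le> real (2 * H)" by (rule of_nat_mono)
    then have K: "real K * real h \<le> 2 * real H" by simp
    let ?F = "\<lambda>(a, x). (a + poly f x) mod m"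
    define J where "J j = {int (j * h) + 1..int (j * h) + int h}" for j
    have cover: "Z \<times> {1..int H} \<subseteq> (\<Union>j\<in>{..<K}. Z \<times> J j)"
    proof clarify
      fix a x assume "a \<in> Z" "x \<in> {1..int H}"
      define n where "n = nat (x - 1)"
      have n: "x = int n + 1" "n < H" using \<open>x \<in> {1..int H}\<close> by (auto simp: n_def)
      have "n div h \<le> H div h" using n by (intro div_le_mono) auto
      then have "n div h < K" by (simp add: K_def)
      moreover have "n div h * h \<le> n" "n < n div h * h + h"
        using h dividend_less_div_times[of h n] by auto
      then have "x \<in> J (n div h)" unfolding J_def n(1) by (simp only: atLeastAtMost_iff) linarith
      ultimately show "(a, x) \<in> (\<Union>j\<in>{..<K}. Z \<times> J j)" using \<open>a \<in> Z\<close> by blast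
    qed
    have piece: "real (card (collisions ?F (Z \<times> J j))) \<le> C * (z * (real h + z)) * real H powr \<epsilon>" for j
    proof -
      \<comment> \<open>Substituting a monic linear polynomial preserves both the degree and the
        leading coefficient.\<close>
      define g where "g = pcompose f [:int (j * h), 1:]"
      have "card (collisions ?F (Z \<times> J j)) \<le> card (collisions (\<lambda>(a, x). (a + poly g x) mod m) (Z \<times> {1..int h}))"
        unfolding J_def using finZ by (intro card_collisions_shift) (auto simp: g_def poly_pcompose)
      then have "real (card (collisions ?F (Z \<times> J j)))
        \<le> real (card (collisions (\<lambda>(a, x). (a + poly g x) mod m) (Z \<times> {1..int h})))" by simp
      also have "\<dots> \<le> C * (z * (real h + z)) * real h powr \<epsilon>"
        unfolding z_def
      proof (rule short)
        show "degree g = d" by (simp add: g_def degree_pcompose f)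
        show "coprime (lead_coeff g) m" using f(2) by (simp add: g_def lead_coeff_comp)
      qed (use m h Z in \<open>auto simp: D_def\<close>)
      also have "\<dots> \<le> C * (z * (real h + z)) * real H powr \<epsilon>"
        using C h \<open>\<epsilon> > 0\<close> by (intro mult_left_mono powr_mono2) (auto simp: z_def)
      finally show ?thesis .
    qed
    have "additive_energy_mod m Z (poly_image_mod m f {1..H0}) \<le> card (collisions ?F (Z \<times> {1..int H}))"
      unfolding H(1) using finZ by (intro additive_energy_le_collisions) auto
    also have "\<dots> \<le> card {..<K} * (\<Sum>j\<in>{..<K}. card (collisions ?F (Z \<times> J j)))"
      using cover finZ by (intro collisions_cover) (auto simp: J_def)
    finally have "real (additive_energy_mod m Z (poly_image_mod m f {1..H0}))
      \<le> real (K * (\<Sum>j\<in>{..<K}. card (collisions ?F (Z \<times> J j))))"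
      by (simp only: of_nat_le_iff card_lessThan)
    also have "\<dots> = real K * (\<Sum>j\<in>{..<K}. real (card (collisions ?F (Z \<times> J j))))" by simp
    also have "\<dots> \<le> real K * (\<Sum>j\<in>{..<K}. C * (z * (real h + z)) * real H powr \<epsilon>)"
      using piece by (intro mult_left_mono sum_mono) auto
    also have "\<dots> = ((real K)\<^sup>2 * (z * (real h + z))) * (C * real H powr \<epsilon>)"
      by (simp add: power2_eq_square)
    also have "\<dots> \<le> (16 * ((real H)\<^sup>2 * z\<^sup>2 / M + z * (real H + z))) * (C * real H powr \<epsilon>)"
    proof (intro mult_right_mono)
      have z: "z \<ge> 0" "z \<le> z\<^sup>2"
        by (auto simp: z_def power2_eq_square simp flip: of_nat_mult)
      have M: "M > 0" using m by (simp add: M_def)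
      show "(real K)\<^sup>2 * (z * (real h + z)) \<le> 16 * ((real H)\<^sup>2 * z\<^sup>2 / M + z * (real H + z))"
      \<comment> \<open>If the whole interval is admissible, the term \<open>z * (H + z)\<close>
        suffices. Otherwise \<open>K\<^sup>2 * h\<close> is at most
        \<open>4 * H\<^sup>2 / h\<close>, hence at most \<open>8 * H\<^sup>2 / M\<close>, and the
        first term suffices.\<close>
      proof (cases "h = H")
        case True
        then have "real K \<le> 2" using K H by simp
        then have "(real K)\<^sup>2 \<le> 2\<^sup>2" by (intro power_mono) auto
        then have "(real K)\<^sup>2 * (z * (real h + z)) \<le> 16 * (z * (real H + z))"
          unfolding True using z by (intro mult_right_mono) auto
        also have "\<dots> \<le> 16 * ((real H)\<^sup>2 * z\<^sup>2 / M + z * (real H + z))"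
          using M by (intro mult_left_mono) auto
        finally show ?thesis .
      next
        case False
        then have Mh: "M \<le> 2 * real h" using large h by simp
        have h1: "real h \<ge> 1" using h by simp
        have "z * (real h + z) \<le> 2 * (real h * z\<^sup>2)"
        proof -
          have "z * real h \<le> real h * z\<^sup>2" using z h1 by (simp add: mult.commute mult_left_mono)
          moreover have "z * z \<le> real h * z\<^sup>2"
            using h1 mult_right_mono[of 1 "real h" "z\<^sup>2"] by (simp add: power2_eq_square)
          ultimately show ?thesis by (simp add: algebra_simps)
        qed
        then have "(real K)\<^sup>2 * (z * (real h + z)) * M \<le> (real K)\<^sup>2 * (2 * (real h * z\<^sup>2)) * (2 * real h)"
          using Mh M by (intro mult_mono[OF mult_left_mono Mh]) auto
        also have "\<dots> = 4 * (real K * real h)\<^sup>2 * z\<^sup>2" by (simp add: power2_eq_square)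
        also have "\<dots> \<le> 4 * (2 * real H)\<^sup>2 * z\<^sup>2"
          using K by (intro mult_right_mono mult_left_mono power_mono) auto
        also have "\<dots> = 16 * ((real H)\<^sup>2 * z\<^sup>2)" by (simp add: power2_eq_square)
        finally have "(real K)\<^sup>2 * (z * (real h + z)) \<le> 16 * ((real H)\<^sup>2 * z\<^sup>2 / M)"
          using M by (simp add: pos_le_divide_eq)
        also have "\<dots> \<le> 16 * ((real H)\<^sup>2 * z\<^sup>2 / M + z * (real H + z))"
          using z by (intro mult_left_mono) auto
        finally show ?thesis .
      qed
    qed (use C in auto)
    finally show "real (additive_energy_mod m Z (poly_image_mod m f {1..H0}))
        \<le> ((real_of_int H0)\<^sup>2 * (real (card Z))\<^sup>2 / real_of_int m powr (2 / (real d * (real d + 1)))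
            + real (card Z) * (real_of_int H0 + real (card Z)))
          * (16 * C * real_of_int H0 powr \<epsilon>)"
      unfolding z_def M_def H(1) by (simp add: mult_ac)
  qed
qed

end
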